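(* Let $\mathcal{L}=\{l_1, l_2, \dots, l_s\}$ be a set of $s$ positive integers with $0 < l_{1} < l_{2} < \cdots < l_{s}$ and let $\mathbb{F}_{q}$ be a finite field of order $q$. Suppose that $\mathcal{V}$ is a collection of subspaces of an $n$-dimensional vector space over $\mathbb{F}_{q}$ such that $\dim(V_{i} \cap V_{j}) \in \mathcal{L}$ for any distinct subspaces $V_{i}, V_{j}$ in $\mathcal{V}$. Let $k = \max_{V \in \mathcal{V}} \dim(V)$. If \[n \geq \max\left\{\log_{q}\left((q^{s}-1)\begin{bmatrix} k^{2} \\ l_{1} + 1 \end{bmatrix}_q + 1 \right) + l_{1},\; 2s + 1\right\},\] then \[|\mathcal{V}| < \begin{bmatrix} n \\ s\end{bmatrix}_q.\]
   Context: For integers $n\ge k\ge 0$, the Gaussian binomial coefficient is $\begin{bmatrix} n \\ k\end{bmatrix}_q = \prod_{0 \leq i \leq k - 1}\frac{q^{n - i} - 1}{q^{k - i} - 1}$; it equals the number of $k$-dimensional subspaces of an $n$-dimensional vector space over $\mathbb{F}_q$. *)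

theory Defs
  imports "HOL-Analysis.Analysis"
begin

text \<open>
  Every factor of the denominator is positive for \<open>q \<ge> 2\<close>. For \<open>k > n\<close> the factor at \<open>i = n\<close> is zero,
  so the value is then \<open>0\<close>, the number of \<open>k\<close>-dimensional subspaces in this case, and the
  truncated differences \<open>n - i\<close> with \<open>i > n\<close> do not matter.
\<close>

definition gauss_binomial :: "nat \<Rightarrow> nat \<Rightarrow> nat \<Rightarrow> real" where
  "gauss_binomial q n k = (\<Prod>i<k. (real q ^ (n - i) - 1) / (real q ^ (k - i) - 1))"

end

theory Submission
  imports Defs "HOL-Library.Function_Algebras"
begin

text \<open>
  A family of subspaces that all contain a fixed \<open>T\<close> and whose pairwise intersections have dimensions in
  \<open>K\<close> has at most as many members as an \<open>(n - dim T)\<close>-dimensional space has subspaces of dimension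
  at most \<open>card K\<close>. To see this, let \<open>C\<close> be a complement of \<open>T\<close>. The functions
  \<open>X \<mapsto> \<Prod>(q\<^bsup>dim (V \<inter> X)\<^esup> - q\<^bsup>l\<^esup>)\<close>, with \<open>l \<in> K\<close>, \<open>l < dim V\<close>, form a triangular system when the
  members are ordered by dimension. On the family, \<open>q\<^bsup>dim (V \<inter> X)\<^esup>\<close> is \<open>q\<^bsup>dim T\<^esup>\<close> times the number of
  vectors of \<open>V \<inter> C\<close> in \<open>X\<close>, so these functions are combinations of the
  indicators of \<open>U \<subseteq> X\<close> with \<open>U \<subseteq> C\<close> spanned by at most \<open>card K\<close> vectors.

  If all members share a nonzero vector \<open>x\<close>, this bound with \<open>T = span {x}\<close> suffices. If their common
  intersection has dimension less than \<open>l\<^sub>1\<close>, then so does the intersection of some \<open>k + 1\<close> members. The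
  span \<open>Y\<close> of these has dimension at most \<open>k\<^sup>2\<close>, and every member meets \<open>Y\<close> in dimension at least
  \<open>l\<^sub>1 + 1\<close>. Apply the bound to the members containing \<open>T\<close>, for each \<open>(l\<^sub>1 + 1)\<close>-dimensional
  \<open>T \<subseteq> Y\<close>; only \<open>s - 1\<close> intersection dimensions remain.
\<close>

subsection \<open>Gaussian binomial coefficients\<close>

lemma gauss_binomial_0 [simp]: "gauss_binomial q n 0 = 1"
  by (simp add: gauss_binomial_def)

lemma gauss_binomial_nonneg: "q \<ge> 2 \<Longrightarrow> gauss_binomial q n k \<ge> 0"
  unfolding gauss_binomial_def by (intro prod_nonneg divide_nonneg_nonneg ballI) auto

lemma gauss_binomial_pos:
  assumes "q \<ge> 2" "k \<le> n"
  shows "gauss_binomial q n k > 0"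
  unfolding gauss_binomial_def using assms by (intro prod_pos divide_pos_pos ballI) auto

lemma gauss_binomial_eq_0: "n < k \<Longrightarrow> gauss_binomial q n k = 0"
  unfolding gauss_binomial_def by (rule prod_zero) (auto intro!: bexI[of _ n])

lemma gauss_binomial_mono:
  assumes "q \<ge> 2" "n \<le> m"
  shows "gauss_binomial q n k \<le> gauss_binomial q m k"
proof (cases "k \<le> n")
  case True
  show ?thesis unfolding gauss_binomial_def
    using assms True
    by (intro prod_mono conjI divide_nonneg_nonneg divide_right_mono diff_right_mono power_increasing) auto
next
  case False
  then show ?thesis using assms by (simp add: gauss_binomial_eq_0 gauss_binomial_nonneg)
qed

lemma gauss_binomial_Suc_Suc:
  "gauss_binomial q (Suc n) (Suc k) = (real q ^ Suc n - 1) / (real q ^ Suc k - 1) * gauss_binomial q n k"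
  unfolding gauss_binomial_def by (subst prod.lessThan_Suc_shift) simp

lemma gauss_binomial_Suc_right:
  "gauss_binomial q n (Suc k) = gauss_binomial q n k * (real q ^ (n - k) - 1) / (real q ^ Suc k - 1)"
proof -
  have "(\<Prod>i<Suc k. real q ^ (Suc k - i) - 1) = (real q ^ Suc k - 1) * (\<Prod>i<k. real q ^ (k - i) - 1)"
    by (subst prod.lessThan_Suc_shift) simp
  then show ?thesis
    unfolding gauss_binomial_def prod_dividef by simp
qed

lemma gauss_binomial_pascal:
  assumes "q \<ge> 2" "k \<le> n"
  shows "gauss_binomial q (Suc n) (Suc k) =
           gauss_binomial q n (Suc k) + real q ^ (n - k) * gauss_binomial q n k"
proof -
  have "real q ^ Suc n = real q ^ (n - k) * real q ^ Suc k"
    using assms by (simp flip: power_add)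
  moreover have "real q ^ Suc k > 1"
    using assms by (intro one_less_power) auto
  ultimately show ?thesis
    unfolding gauss_binomial_Suc_Suc[of q n k] gauss_binomial_Suc_right[of q n k]
    by (simp add: divide_simps) (auto simp: algebra_simps)
qed

text \<open>The ratio of consecutive coefficients is
  \<open>(q ^ (n - k) - 1) / (q ^ (k + 1) - 1)\<close>, which is at least 1 once
  \<open>n - k\<close> reaches \<open>k + 1\<close>.\<close>

lemma gauss_binomial_le_Suc:
  assumes "q \<ge> 2" "2 * k + 1 \<le> n"
  shows "gauss_binomial q n k \<le> gauss_binomial q n (Suc k)"
proof -
  have gt: "real q ^ Suc k > 1"
    using assms by (intro one_less_power) auto
  have "real q ^ Suc k \<le> real q ^ (n - k)"
    using assms by (intro power_increasing) auto
  with gt have "1 \<le> (real q ^ (n - k) - 1) / (real q ^ Suc k - 1)"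
    by simp
  from mult_left_mono[OF this gauss_binomial_nonneg[OF assms(1)], of n k]
  show ?thesis unfolding gauss_binomial_Suc_right by simp
qed

lemma sum_gauss_binomial_le:
  assumes "q \<ge> 2" "2 * k \<le> n"
  shows "(\<Sum>i\<le>k. gauss_binomial q n i) \<le> real (Suc k) * gauss_binomial q n k"
  using assms(2)
proof (induction k)
  case (Suc k)
  have "(\<Sum>i\<le>Suc k. gauss_binomial q n i) \<le> real (Suc k) * gauss_binomial q n k + gauss_binomial q n (Suc k)"
    using Suc by simp
  also have "\<dots> \<le> real (Suc k) * gauss_binomial q n (Suc k) + gauss_binomial q n (Suc k)"
    using Suc.prems gauss_binomial_le_Suc[OF assms(1), of k n] by (intro add_right_mono mult_left_mono) auto
  finally show ?case by (simp add: algebra_simps)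
qed simp

text \<open>Pascal's rule leaves \<open>q ^ (n - k)\<close> copies of the coefficient at
  \<open>k\<close> to pay for all terms up to \<open>k\<close>. By monotonicity these amount to at
  most \<open>k + 1\<close> copies, and \<open>k + 1 < 2 ^ (n - k)\<close>. A whole sum is thus
  traded for one coefficient a dimension higher.\<close>

lemma sum_gauss_binomial_less:
  assumes "q \<ge> 2" "2 * Suc k \<le> n"
  shows "(\<Sum>i\<le>Suc k. gauss_binomial q n i) < gauss_binomial q (Suc n) (Suc k)"
proof -
  have "Suc k < (2::nat) ^ (n - k)"
    using assms(2) by (intro less_trans[OF _ less_exp]) simp
  also have "(2::nat) ^ (n - k) \<le> q ^ (n - k)"
    using assms(1) by (intro power_mono) auto
  finally have "real (Suc k) < real q ^ (n - k)"
    by (metis of_nat_less_iff of_nat_power)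
  then have "real (Suc k) * gauss_binomial q n k < real q ^ (n - k) * gauss_binomial q n k"
    using assms gauss_binomial_pos[of q k n] by (intro mult_strict_right_mono) auto
  moreover have "(\<Sum>i\<le>k. gauss_binomial q n i) \<le> real (Suc k) * gauss_binomial q n k"
    using assms by (intro sum_gauss_binomial_le) auto
  ultimately show ?thesis
    using assms by (simp add: gauss_binomial_pascal)
qed

subsection \<open>Triangular systems of real functions\<close>

interpretation real_fun: vector_space "\<lambda>(c::real) (f::'a \<Rightarrow> real) x. c * f x"
  by unfold_locales (auto simp: fun_eq_iff algebra_simps)

lemma sum_fun_apply: "(\<Sum>i\<in>A. f i) x = (\<Sum>i\<in>A. f i x :: real)"
  by (induction A rule: infinite_finite_induct) auto

text \<open>Evaluate a nontrivial relation among the \<open>h v\<close> at a member of least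
  \<open>d\<close> in its support: every other term vanishes there, the diagonal one does
  not.\<close>

lemma card_le_of_triangular:
  fixes h :: "'a \<Rightarrow> 'a \<Rightarrow> real" and d :: "'a \<Rightarrow> nat"
  assumes "finite F" "finite B"
    and span: "\<And>v. v \<in> F \<Longrightarrow> h v \<in> real_fun.span B"
    and diag: "\<And>v. v \<in> F \<Longrightarrow> h v v \<noteq> 0"
    and zero: "\<And>v w. v \<in> F \<Longrightarrow> w \<in> F \<Longrightarrow> v \<noteq> w \<Longrightarrow> d w \<le> d v \<Longrightarrow> h v w = 0"
  shows "card F \<le> card B"
proof -
  have inj: "inj_on h F"
  proof (rule inj_onI, rule ccontr)
    fix v w assume *: "v \<in> F" "w \<in> F" "h v = h w" "v \<noteq> w"
    have "d w \<le> d v \<or> d v \<le> d w" by linarith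
    with * zero[of v w] zero[of w v] diag[of v] diag[of w] show False by auto
  qed
  have "real_fun.independent (h ` F)"
  proof
    assume "real_fun.dependent (h ` F)"
    then obtain u where u: "\<exists>f\<in>h ` F. u f \<noteq> 0" "(\<Sum>f\<in>h ` F. (\<lambda>x. u f * f x)) = 0"
      using assms(1) by (auto simp: real_fun.dependent_finite)
    define S where "S = {v \<in> F. u (h v) \<noteq> 0}"
    have "S \<noteq> {}" using u(1) by (auto simp: S_def)
    then obtain v where v: "v \<in> S" and min: "\<And>w. w \<in> S \<Longrightarrow> d v \<le> d w"
      using ex_has_least_nat[of "\<lambda>v. v \<in> S" _ d] by blast
    have "0 = (\<Sum>f\<in>h ` F. (\<lambda>x. u f * f x)) v"
      using u(2) by simp
    also have "\<dots> = (\<Sum>w\<in>F. u (h w) * h w v)"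
      by (simp add: sum_fun_apply sum.reindex[OF inj])
    also have "\<dots> = (\<Sum>w\<in>{v}. u (h w) * h w v)"
      using v min zero assms(1)
      by (intro sum.mono_neutral_right) (force simp: S_def)+
    also have "\<dots> \<noteq> 0"
      using v diag by (simp add: S_def)
    finally show False by simp
  qed
  from real_fun.independent_span_bound[OF assms(2) this] span
  have "card (h ` F) \<le> card B" by auto
  then show ?thesis by (simp add: card_image[OF inj])
qed

subsection \<open>Subspaces over a finite field\<close>

locale finite_field_vector_space = finite_dimensional_vector_space scale Basis
  for scale :: "'a::{field,finite} \<Rightarrow> 'b::ab_group_add \<Rightarrow> 'b" (infixr "*s" 75)
    and Basis :: "'b set"
begin

lemma card_field_ge_2: "CARD('a) \<ge> 2"
proof -
  have "card {0, 1 :: 'a} \<le> CARD('a)"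
    by (rule card_mono) auto
  then show ?thesis by simp
qed

text \<open>Adjoining a vector \<open>a\<close> outside the span multiplies the count by the field
  size: each vector of the larger span is \<open>k *s a + y\<close> for a unique scalar
  \<open>k\<close> and a unique \<open>y\<close> in the old span.\<close>

lemma card_span_independent:
  assumes "independent B"
  shows "finite (span B) \<and> card (span B) = CARD('a) ^ card B"
  using finiteI_independent[OF assms] assms
proof (induction B rule: finite_induct)
  case (insert a B)
  have a: "a \<notin> span B" and B: "independent B"
    using insert by (auto simp: independent_insert)
  have "bij_betw (\<lambda>(k, y). k *s a + y) (UNIV \<times> span B) (span (insert a B))"
    unfolding bij_betw_def
  proof
    show "inj_on (\<lambda>(k, y). k *s a + y) (UNIV \<times> span B)"
    proof (rule inj_onI, clarify)
      fix k y k' y' assume *: "y \<in> span B" "y' \<in> span B" "k *s a + y = k' *s a + y'"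
      then have eq: "(k - k') *s a = y' - y"
        by (simp add: scale_left_diff_distrib algebra_simps)
      have "k = k'"
      proof (rule ccontr)
        assume "k \<noteq> k'"
        then have "a = inverse (k - k') *s (y' - y)"
          by (simp flip: eq)
        also have "\<dots> \<in> span B"
          using * by (intro span_scale span_diff)
        finally show False using a by simp
      qed
      with * show "k = k' \<and> y = y'" by simp
    qed
    show "(\<lambda>(k, y). k *s a + y) ` (UNIV \<times> span B) = span (insert a B)"
    proof (intro equalityI subsetI)
      fix x assume "x \<in> (\<lambda>(k, y). k *s a + y) ` (UNIV \<times> span B)"
      then show "x \<in> span (insert a B)"
        by (auto intro!: span_add intro: span_scale span_base span_mono[THEN subsetD, of B])
    next
      fix x assume "x \<in> span (insert a B)"
      then obtain k where "x - k *s a \<in> span B"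
        by (auto simp: span_insert)
      then show "x \<in> (\<lambda>(k, y). k *s a + y) ` (UNIV \<times> span B)"
        by (intro image_eqI[of _ _ "(k, x - k *s a)"]) auto
    qed
  qed
  from bij_betw_finite[OF this] bij_betw_same_card[OF this] insert B show ?case
    by (simp add: card_cartesian_product)
qed simp

lemma finite_vectors [simp]: "finite (A :: 'b set)"
  using card_span_independent[OF independent_Basis] span_Basis finite_subset[of A UNIV] by simp

lemma card_subspace:
  assumes "subspace S"
  shows "card S = CARD('a) ^ dim S"
  using basis_subspace_exists[OF assms] card_span_independent by metis

section \<open>Counting the subspaces of a given dimension\<close>

definition indep_lists :: "'b set \<Rightarrow> nat \<Rightarrow> 'b list set" where
  "indep_lists S i = {xs. length xs = i \<and> distinct xs \<and> independent (set xs) \<and> set xs \<subseteq> S}"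

definition subspaces_of_dim :: "'b set \<Rightarrow> nat \<Rightarrow> 'b set set" where
  "subspaces_of_dim S i = {U. subspace U \<and> U \<subseteq> S \<and> dim U = i}"

lemma finite_indep_lists [simp]: "finite (indep_lists S i)"
  by (rule finite_subset[OF _ finite_lists_length_eq[of S i]]) (auto simp: indep_lists_def)

lemma finite_subspaces_of_dim [simp]: "finite (subspaces_of_dim S i)"
  by (rule finite_subset[of _ UNIV]) (auto simp: finite_Collect_subsets Finite_Set.finite_set)

text \<open>A list of length \<open>i\<close> extends by any vector of \<open>S\<close> outside its
  span, which has \<open>CARD('a) ^ i\<close> elements. For \<open>i > dim S\<close> the factor at
  \<open>j = dim S\<close> makes the product zero.\<close>

lemma card_indep_lists:
  assumes "subspace S"
  shows "real (card (indep_lists S i)) = (\<Prod>j<i. real CARD('a) ^ dim S - real CARD('a) ^ j)"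
proof (induction i)
  case 0
  have "indep_lists S 0 = {[]}"
    by (auto simp: indep_lists_def independent_empty)
  then show ?case by simp
next
  case (Suc i)
  let ?A = "Sigma (indep_lists S i) (\<lambda>xs. S - span (set xs))"
  have "bij_betw (\<lambda>(xs, x). x # xs) ?A (indep_lists S (Suc i))"
    unfolding bij_betw_def
  proof
    show "inj_on (\<lambda>(xs, x). x # xs) ?A"
      by (auto simp: inj_on_def)
    show "(\<lambda>(xs, x). x # xs) ` ?A = indep_lists S (Suc i)"
    proof (intro equalityI subsetI)
      fix ys assume "ys \<in> (\<lambda>(xs, x). x # xs) ` ?A"
      then show "ys \<in> indep_lists S (Suc i)"
        by (auto simp: indep_lists_def independent_insertI dest: span_base)
    next
      fix ys assume "ys \<in> indep_lists S (Suc i)"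
      then obtain x xs where "ys = x # xs" "length xs = i" "distinct xs" "x \<notin> set xs"
        "independent (insert x (set xs))" "x \<in> S" "set xs \<subseteq> S"
        by (auto simp: indep_lists_def length_Suc_conv)
      then show "ys \<in> (\<lambda>(xs, x). x # xs) ` ?A"
        by (intro image_eqI[of _ _ "(xs, x)"]) (auto simp: indep_lists_def independent_insert)
    qed
  qed
  then have "card (indep_lists S (Suc i)) = card ?A"
    by (simp add: bij_betw_same_card)
  also have "\<dots> = (\<Sum>xs\<in>indep_lists S i. card (S - span (set xs)))"
    by (simp add: card_SigmaI)
  finally have "real (card (indep_lists S (Suc i))) = (\<Sum>xs\<in>indep_lists S i. real (card (S - span (set xs))))"
    by simp
  also have "\<dots> = (\<Sum>xs\<in>indep_lists S i. real CARD('a) ^ dim S - real CARD('a) ^ i)"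
  proof (rule sum.cong[OF refl])
    fix xs assume xs: "xs \<in> indep_lists S i"
    then have sub: "span (set xs) \<subseteq> S"
      using assms by (intro span_minimal) (auto simp: indep_lists_def)
    have "card (span (set xs)) = CARD('a) ^ i"
      using xs card_span_independent[of "set xs"] by (auto simp: indep_lists_def distinct_card)
    then show "real (card (S - span (set xs))) = real CARD('a) ^ dim S - real CARD('a) ^ i"
      using sub card_mono[of S "span (set xs)"] assms
      by (simp add: card_Diff_subset card_subspace of_nat_diff)
  qed
  finally show ?case by (simp add: Suc)
qed

text \<open>Double counting of ordered bases: an independent list of length \<open>i\<close> in
  \<open>S\<close> is a basis of exactly one \<open>i\<close>-dimensional subspace, its span, and
  all these subspaces have equally many ordered bases.\<close>

lemma card_subspaces_of_dim:
  assumes "subspace S"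
  shows "real (card (subspaces_of_dim S i)) = gauss_binomial CARD('a) (dim S) i"
proof (cases "i \<le> dim S")
  case True
  let ?q = "real CARD('a)"
  have q: "?q > 1" using card_field_ge_2 by linarith
  have span_eq: "span (set xs) = U" if "xs \<in> indep_lists U i" "U \<in> subspaces_of_dim S i" for xs U
    using that by (intro subspace_dim_equal subspace_span span_minimal)
      (auto simp: indep_lists_def subspaces_of_dim_def dim_eq_card_independent distinct_card)
  have "indep_lists S i = (\<Union>U\<in>subspaces_of_dim S i. indep_lists U i)"
  proof (intro equalityI subsetI)
    fix xs assume xs: "xs \<in> indep_lists S i"
    then have "span (set xs) \<in> subspaces_of_dim S i"
      using assms by (auto simp: indep_lists_def subspaces_of_dim_def dim_eq_card_independent distinct_card
          dest: span_minimal[THEN subsetD])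
    moreover have "xs \<in> indep_lists (span (set xs)) i"
      using xs by (auto simp: indep_lists_def span_base)
    ultimately show "xs \<in> (\<Union>U\<in>subspaces_of_dim S i. indep_lists U i)" by blast
  qed (auto simp: indep_lists_def subspaces_of_dim_def)
  moreover have "card (\<Union>U\<in>subspaces_of_dim S i. indep_lists U i) = (\<Sum>U\<in>subspaces_of_dim S i. card (indep_lists U i))"
    using span_eq by (intro card_UN_disjoint) auto
  ultimately have "real (card (indep_lists S i)) = (\<Sum>U\<in>subspaces_of_dim S i. real (card (indep_lists U i)))"
    by simp
  also have "\<dots> = real (card (subspaces_of_dim S i)) * (\<Prod>j<i. ?q ^ i - ?q ^ j)"
    by (simp add: subspaces_of_dim_def card_indep_lists)
  finally have eq: "(\<Prod>j<i. ?q ^ dim S - ?q ^ j) = real (card (subspaces_of_dim S i)) * (\<Prod>j<i. ?q ^ i - ?q ^ j)"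
    by (simp add: card_indep_lists[OF assms])
  have nz: "(\<Prod>j<i. ?q ^ i - ?q ^ j) \<noteq> 0"
    using q by (auto simp: power_inject_exp)
  have "real (card (subspaces_of_dim S i)) = (\<Prod>j<i. (?q ^ dim S - ?q ^ j) / (?q ^ i - ?q ^ j))"
    using eq nz by (simp add: prod_dividef field_simps)
  also have "\<dots> = gauss_binomial CARD('a) (dim S) i"
    unfolding gauss_binomial_def
  proof (rule prod.cong[OF refl])
    fix j assume "j \<in> {..<i}"
    then have "?q ^ dim S - ?q ^ j = ?q ^ j * (?q ^ (dim S - j) - 1)" "?q ^ i - ?q ^ j = ?q ^ j * (?q ^ (i - j) - 1)"
      using True by (simp_all add: algebra_simps flip: power_add)
    then show "(?q ^ dim S - ?q ^ j) / (?q ^ i - ?q ^ j) = (?q ^ (dim S - j) - 1) / (?q ^ (i - j) - 1)"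
      using q by simp
  qed
  finally show ?thesis .
next
  case False
  then have "subspaces_of_dim S i = {}"
    by (auto simp: subspaces_of_dim_def dest: dim_subset)
  with False show ?thesis by (simp add: gauss_binomial_eq_0)
qed

section \<open>Complements of a subspace\<close>

lemma subspace_complement:
  assumes "subspace T"
  obtains C where "subspace C" "T \<inter> C = {0}" "{x + y |x y. x \<in> T \<and> y \<in> C} = UNIV"
proof -
  obtain B where B: "B \<subseteq> T" "independent B" "span B = T"
    using basis_subspace_exists[OF assms] by metis
  define E where "E = extend_basis B"
  have E: "B \<subseteq> E" "independent E" "span E = UNIV"
    unfolding E_def using B(2) extend_basis_superset independent_extend_basis span_extend_basis by auto
  let ?C = "span (E - B)"
  have "B \<union> (E - B) = E" using E(1) by auto
  then have sum: "{x + y |x y. x \<in> T \<and> y \<in> ?C} = UNIV"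
    using span_Un[of B "E - B"] B(3) E(3) by simp
  \<comment> \<open>The two dimensions add up to that of the whole space, which is the sum of the
    two subspaces, so the dimension formula leaves 0 for the intersection.\<close>
  have "dim T + dim ?C = card B + card (E - B)"
    using B E independent_mono[of E "E - B"] dim_span_eq_card_independent by (metis Diff_subset)
  also have "\<dots> = card E"
    using E(1) by (simp add: card_Diff_subset card_mono)
  also have "\<dots> = dim (UNIV :: 'b set)"
    using E dim_span_eq_card_independent by metis
  finally have "dim (T \<inter> ?C) = 0"
    using dim_sums_Int[OF assms subspace_span, of "E - B"] sum by simp
  then have "T \<inter> ?C = {0}"
    using subspace_0[OF assms] span_zero by auto
  with sum that[of ?C] show ?thesis by simp
qed

text \<open>Modular law: since \<open>V\<close> contains \<open>T\<close>, splitting a vector of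
  \<open>V\<close> along \<open>T\<close> and \<open>C\<close> leaves both parts in
  \<open>V\<close>, so \<open>V\<close> is the direct sum of \<open>T\<close> and
  \<open>V \<inter> C\<close>.\<close>

lemma card_Int_complement:
  assumes "subspace T" "subspace C" "T \<inter> C = {0}" "{x + y |x y. x \<in> T \<and> y \<in> C} = UNIV"
    and "subspace V" "T \<subseteq> V"
  shows "card V = card T * card (V \<inter> C)"
proof -
  have "bij_betw (\<lambda>(x, y). x + y) (T \<times> (V \<inter> C)) V"
    unfolding bij_betw_def
  proof
    show "inj_on (\<lambda>(x, y). x + y) (T \<times> (V \<inter> C))"
    proof (rule inj_onI, clarify)
      fix x y x' y' assume *: "x \<in> T" "x' \<in> T" "y \<in> C" "y' \<in> C" "x + y = x' + y'"
      then have eq: "x - x' = y' - y" by (simp add: algebra_simps)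
      have "x - x' \<in> T" using * assms(1) by (intro subspace_diff)
      moreover have "x - x' \<in> C" unfolding eq using * assms(2) by (intro subspace_diff)
      ultimately have "x - x' = 0" using assms(3) by blast
      with * show "x = x' \<and> y = y'" by simp
    qed
    show "(\<lambda>(x, y). x + y) ` (T \<times> (V \<inter> C)) = V"
    proof (intro equalityI subsetI)
      fix v assume v: "v \<in> V"
      obtain x y where xy: "v = x + y" "x \<in> T" "y \<in> C" using assms(4) by blast
      then have "y = v - x" by simp
      then have "y \<in> V" using v xy assms(5,6) subspace_diff by blast
      with xy show "v \<in> (\<lambda>(x, y). x + y) ` (T \<times> (V \<inter> C))" by auto
    qed (use assms(5,6) in \<open>auto intro: subspace_add\<close>)
  qed
  from bij_betw_same_card[OF this] show ?thesis
    by (simp add: card_cartesian_product)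
qed

subsection \<open>Families with few intersection dimensions\<close>

text \<open>
  Restricting the indicator to subspaces \<open>X\<close> makes \<open>x \<in> X\<close> and \<open>U \<subseteq> X\<close> together equivalent to
  \<open>span (insert x U) \<subseteq> X\<close>.
\<close>

definition contains_ind :: "'b set \<Rightarrow> 'b set \<Rightarrow> real" where
  "contains_ind U X = of_bool (subspace X \<and> U \<subseteq> X)"

definition subspaces_upto_dim :: "'b set \<Rightarrow> nat \<Rightarrow> 'b set set" where
  "subspaces_upto_dim C j = {U. subspace U \<and> U \<subseteq> C \<and> dim U \<le> j}"

lemma card_subspaces_upto_dim:
  assumes "subspace C"
  shows "real (card (subspaces_upto_dim C j)) \<le> (\<Sum>i\<le>j. gauss_binomial CARD('a) (dim C) i)"
proof -
  have "subspaces_upto_dim C j = (\<Union>i\<le>j. subspaces_of_dim C i)"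
    by (auto simp: subspaces_upto_dim_def subspaces_of_dim_def)
  then have "card (subspaces_upto_dim C j) \<le> (\<Sum>i\<le>j. card (subspaces_of_dim C i))"
    by (simp add: card_UN_le)
  then have "real (card (subspaces_upto_dim C j)) \<le> (\<Sum>i\<le>j. real (card (subspaces_of_dim C i)))"
    by (simp flip: of_nat_sum)
  then show ?thesis by (simp add: card_subspaces_of_dim[OF assms])
qed

lemma contains_ind_span_mono:
  assumes "i \<le> j"
  shows "real_fun.span (contains_ind ` subspaces_upto_dim C i) \<subseteq> real_fun.span (contains_ind ` subspaces_upto_dim C j)"
  using assms by (intro real_fun.span_mono image_mono) (auto simp: subspaces_upto_dim_def)

text \<open>The indicator of \<open>x \<in> X\<close> times \<open>contains_ind U\<close> is
  \<open>contains_ind (span (insert x U))\<close>, at the cost of at most one dimension; the rest is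
  linearity.\<close>

lemma mem_ind_mult_in_span:
  assumes "f \<in> real_fun.span (contains_ind ` subspaces_upto_dim C j)" "x \<in> C" "subspace C"
  shows "(\<lambda>X. of_bool (x \<in> X) * f X) \<in> real_fun.span (contains_ind ` subspaces_upto_dim C (Suc j))"
  using assms(1)
proof (induction rule: real_fun.span_induct_alt)
  case base
  have "(\<lambda>X. of_bool (x \<in> X) * (0 :: 'b set \<Rightarrow> real) X) = 0"
    by (simp add: fun_eq_iff)
  then show ?case using real_fun.span_zero by metis
next
  case (step c g f)
  then obtain U where U: "g = contains_ind U" "subspace U" "U \<subseteq> C" "dim U \<le> j"
    by (auto simp: subspaces_upto_dim_def)
  let ?W = "span (insert x U)"
  have "?W \<in> subspaces_upto_dim C (Suc j)"
    using U assms(2,3) span_minimal[of "insert x U" C] by (simp add: subspaces_upto_dim_def dim_insert)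
  then have "(\<lambda>X. c * contains_ind ?W X) + (\<lambda>X. of_bool (x \<in> X) * f X)
      \<in> real_fun.span (contains_ind ` subspaces_upto_dim C (Suc j))"
    using step by (intro real_fun.span_add real_fun.span_scale) (auto intro: real_fun.span_base)
  moreover have "(\<lambda>X. of_bool (x \<in> X) * ((\<lambda>x. c * g x) + f) X) = (\<lambda>X. c * contains_ind ?W X) + (\<lambda>X. of_bool (x \<in> X) * f X)"
  proof
    fix X
    have "of_bool (x \<in> X) * contains_ind U X = contains_ind ?W X"
      using span_minimal[of "insert x U" X] span_superset[of "insert x U"] by (auto simp: contains_ind_def)
    then show "of_bool (x \<in> X) * ((\<lambda>x. c * g x) + f) X = ((\<lambda>X. c * contains_ind ?W X) + (\<lambda>X. of_bool (x \<in> X) * f X)) X"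
      unfolding U(1) by (simp add: algebra_simps)
  qed
  ultimately show ?case by simp
qed

text \<open>\<open>card (V \<inter> X)\<close> is a sum of indicators of \<open>x \<in> X\<close>,
  so each factor costs one dimension. The factor \<open>of_bool (subspace X)\<close> turns the empty
  product into \<open>contains_ind {0}\<close>.\<close>

lemma prod_card_Int_in_span:
  fixes a :: real and b :: "'c \<Rightarrow> real"
  assumes "finite K" "V \<subseteq> C" "subspace C"
  shows "(\<lambda>X. of_bool (subspace X) * (\<Prod>l\<in>K. a * real (card (V \<inter> X)) - b l))
           \<in> real_fun.span (contains_ind ` subspaces_upto_dim C (card K))"
  using assms(1)
proof (induction K rule: finite_induct)
  case empty
  have "(\<lambda>X. of_bool (subspace X) * (\<Prod>l\<in>{}. a * real (card (V \<inter> X)) - b l)) = contains_ind {0}"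
    by (auto simp: contains_ind_def fun_eq_iff dest: subspace_0)
  moreover have "{0} \<in> subspaces_upto_dim C (card {})"
    using assms(3) by (auto simp: subspaces_upto_dim_def dest: subspace_0)
  ultimately show ?case by (metis imageI real_fun.span_base)
next
  case (insert l K)
  let ?p = "\<lambda>X. of_bool (subspace X) * (\<Prod>l\<in>K. a * real (card (V \<inter> X)) - b l)"
  let ?S = "real_fun.span (contains_ind ` subspaces_upto_dim C (Suc (card K)))"
  have "(\<Sum>x\<in>V. (\<lambda>X. a * (of_bool (x \<in> X) * ?p X))) + (\<lambda>X. (- b l) * ?p X) \<in> ?S"
    using insert.IH assms(2,3) contains_ind_span_mono[of "card K" "Suc (card K)" C]
    by (intro real_fun.span_add real_fun.span_sum real_fun.span_scale mem_ind_mult_in_span) auto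
  also have "(\<Sum>x\<in>V. (\<lambda>X. a * (of_bool (x \<in> X) * ?p X))) + (\<lambda>X. (- b l) * ?p X) =
     (\<lambda>X. of_bool (subspace X) * (\<Prod>l\<in>insert l K. a * real (card (V \<inter> X)) - b l))"
  proof
    fix X
    have "real (card (V \<inter> X)) = (\<Sum>x\<in>V. of_bool (x \<in> X))"
      by simp
    moreover have "(\<Sum>x\<in>V. a * (of_bool (x \<in> X) * ?p X)) = a * (\<Sum>x\<in>V. of_bool (x \<in> X)) * ?p X"
      by (simp only: sum_distrib_left sum_distrib_right mult.assoc)
    ultimately show "((\<Sum>x\<in>V. (\<lambda>X. a * (of_bool (x \<in> X) * ?p X))) + (\<lambda>X. (- b l) * ?p X)) X =
      of_bool (subspace X) * (\<Prod>l\<in>insert l K. a * real (card (V \<inter> X)) - b l)"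
      using insert.hyps by (simp add: sum_fun_apply algebra_simps)
  qed
  finally show ?case using insert.hyps by simp
qed

lemma card_intersecting_family_le:
  assumes T: "subspace T" and F: "\<And>V. V \<in> F \<Longrightarrow> subspace V" "\<And>V. V \<in> F \<Longrightarrow> T \<subseteq> V"
    and K: "finite K" "\<And>V W. V \<in> F \<Longrightarrow> W \<in> F \<Longrightarrow> V \<noteq> W \<Longrightarrow> dim (V \<inter> W) \<in> K"
  shows "real (card F) \<le> (\<Sum>i\<le>card K. gauss_binomial CARD('a) (dim UNIV - dim T) i)"
proof -
  let ?q = "real CARD('a)"
  have q: "?q > 1" using card_field_ge_2 by linarith
  obtain C where C: "subspace C" "T \<inter> C = {0}" "{x + y |x y. x \<in> T \<and> y \<in> C} = UNIV"
    using subspace_complement[OF T] by blast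
  have cV: "?q ^ dim T * real (card (V \<inter> C)) = ?q ^ dim V" if "subspace V" "T \<subseteq> V" for V
    using card_Int_complement[OF T C that] that T by (simp add: card_subspace flip: of_nat_power of_nat_mult)
  have "?q ^ (dim T + dim C) = ?q ^ dim UNIV"
    using cV[of UNIV] C(1) by (simp add: card_subspace power_add)
  then have "dim T + dim C = dim UNIV"
    using q by (simp only: power_inject_exp)
  then have dimC: "dim C = dim UNIV - dim T" by simp
  \<comment> \<open>Keeping only \<open>l < dim V\<close> leaves no zero factor on the diagonal.
    Using \<open>V \<inter> C\<close> in place of \<open>V\<close> keeps the spanning subspaces
    inside \<open>C\<close>.\<close>
  define h where "h V = (\<lambda>X. of_bool (subspace X) *
      (\<Prod>l\<in>{l \<in> K. l < dim V}. ?q ^ dim T * real (card (V \<inter> C \<inter> X)) - ?q ^ l))" for V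
  have h: "h V X = (\<Prod>l\<in>{l \<in> K. l < dim V}. ?q ^ dim (V \<inter> X) - ?q ^ l)" if "V \<in> F" "X \<in> F" for V X
  proof -
    have "?q ^ dim T * real (card (V \<inter> C \<inter> X)) = ?q ^ dim (V \<inter> X)"
      using cV[of "V \<inter> X"] that F by (simp add: subspace_inter Int_ac)
    then show ?thesis using that F by (simp add: h_def)
  qed
  have fin: "finite (subspaces_upto_dim C (card K))"
    by (rule finite_subset[of _ UNIV]) (auto simp: Finite_Set.finite_set)
  have "card F \<le> card (contains_ind ` subspaces_upto_dim C (card K))"
  proof (rule card_le_of_triangular[where h = h and d = dim])
    show "finite F"
      by (rule finite_subset[of _ UNIV]) (auto simp: Finite_Set.finite_set)
    show "finite (contains_ind ` subspaces_upto_dim C (card K))"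
      using fin by simp
  next
    fix V assume "V \<in> F"
    have "h V \<in> real_fun.span (contains_ind ` subspaces_upto_dim C (card {l \<in> K. l < dim V}))"
      unfolding h_def using K(1) C(1) by (intro prod_card_Int_in_span) auto
    moreover have "card {l \<in> K. l < dim V} \<le> card K"
      using K(1) by (intro card_mono) auto
    ultimately show "h V \<in> real_fun.span (contains_ind ` subspaces_upto_dim C (card K))"
      using contains_ind_span_mono by blast
  next
    fix V assume "V \<in> F"
    then show "h V V \<noteq> 0"
      using q K(1) by (auto simp: h power_inject_exp)
  next
    fix V W assume VW: "V \<in> F" "W \<in> F" "V \<noteq> W" "dim W \<le> dim V"
    \<comment> \<open>\<open>V\<close> is not contained in \<open>W\<close>, so
      \<open>dim (V \<inter> W)\<close> is one of the retained \<open>l\<close> and its factor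
      vanishes.\<close>
    have "V \<inter> W \<noteq> V"
    proof
      assume "V \<inter> W = V"
      then have "V \<subseteq> W" by blast
      then have "V = W" using VW F by (intro subspace_dim_equal) auto
      with VW show False by simp
    qed
    then have "dim (V \<inter> W) < dim V"
      using VW F subspace_dim_equal[of "V \<inter> W" V] by (force simp: subspace_inter not_le)
    then show "h V W = 0"
      using VW K by (auto simp: h intro!: bexI[of _ "dim (V \<inter> W)"])
  qed
  also have "\<dots> \<le> card (subspaces_upto_dim C (card K))"
    using fin by (rule card_image_le)
  finally have "real (card F) \<le> real (card (subspaces_upto_dim C (card K)))" by simp
  also have "\<dots> \<le> (\<Sum>i\<le>card K. gauss_binomial CARD('a) (dim C) i)"
    by (rule card_subspaces_upto_dim[OF C(1)])
  finally show ?thesis by (simp add: dimC)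
qed

section \<open>Families with small common intersection\<close>

lemma small_subfamily_small_Inter:
  assumes F: "\<And>V. V \<in> F \<Longrightarrow> subspace V" and "A \<in> F" and m: "dim (\<Inter>F) < m"
  shows "\<exists>G. finite G \<and> A \<in> G \<and> G \<subseteq> F \<and> card G \<le> Suc j \<and> (dim (\<Inter>G) < m \<or> dim (\<Inter>G) + j \<le> dim A)"
proof (induction j)
  case 0
  show ?case using assms(2) by (intro exI[of _ "{A}"]) auto
next
  case (Suc j)
  then obtain G where G: "finite G" "A \<in> G" "G \<subseteq> F" "card G \<le> Suc j"
    "dim (\<Inter>G) < m \<or> dim (\<Inter>G) + j \<le> dim A" by blast
  show ?case
  proof (cases "dim (\<Inter>G) < m")
    case True
    with G show ?thesis by (intro exI[of _ G]) auto
  next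
    case False
    \<comment> \<open>Some member \<open>B\<close> does not contain the current intersection; adding
      it lowers the dimension by at least one.\<close>
    with m have "\<not> \<Inter>G \<subseteq> \<Inter>F" using dim_subset[of "\<Inter>G" "\<Inter>F"] by linarith
    then obtain B where B: "B \<in> F" "\<not> \<Inter>G \<subseteq> B" by blast
    have "subspace (\<Inter>(insert B G))" "subspace (\<Inter>G)"
      using B(1) G(3) F by (auto intro!: subspace_Inter subspace_inter)
    then have "\<not> dim (\<Inter>G) \<le> dim (\<Inter>(insert B G))"
      using subspace_dim_equal[of "\<Inter>(insert B G)" "\<Inter>G"] B(2) by auto
    with G False B show ?thesis
      by (intro exI[of _ "insert B G"]) (auto simp: card_insert_if)
  qed
qed

text \<open>Each new \<open>B\<close> meets \<open>A\<close>, hence the span built so far, in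
  dimension at least 1, and so adds at most \<open>k - 1\<close>.\<close>

lemma dim_span_Union_le:
  assumes "finite G" "subspace A"
    and "\<And>B. B \<in> G \<Longrightarrow> subspace B" "\<And>B. B \<in> G \<Longrightarrow> dim B \<le> k" "\<And>B. B \<in> G \<Longrightarrow> 1 \<le> dim (B \<inter> A)"
  shows "dim (span (A \<union> \<Union>G)) \<le> dim A + card G * (k - 1)"
  using assms(1,3-)
proof (induction G rule: finite_induct)
  case (insert B G)
  let ?Y = "span (A \<union> \<Union>G)"
  have "B \<inter> A \<subseteq> B \<inter> ?Y" using span_superset by blast
  then have 1: "1 \<le> dim (B \<inter> ?Y)" using insert.prems(3)[of B] dim_subset[of "B \<inter> A" "B \<inter> ?Y"] by force
  have sB: "span B = B" using insert.prems(1)[of B] by simp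
  have "span (A \<union> \<Union>(insert B G)) = span (B \<union> (A \<union> \<Union>G))"
    by (simp add: Un_ac)
  also have "\<dots> = {x + y |x y. x \<in> B \<and> y \<in> ?Y}"
    unfolding span_Un[of B "A \<union> \<Union>G"] sB ..
  finally have "dim (span (A \<union> \<Union>(insert B G))) + dim (B \<inter> ?Y) = dim B + dim ?Y"
    using dim_sums_Int[of B ?Y] insert.prems(1) by simp
  moreover have "dim ?Y \<le> dim A + card G * (k - 1)"
    using insert by blast
  moreover have "dim B \<le> k" using insert.prems(2) by simp
  ultimately show ?case
    using 1 insert.hyps by simp
qed simp

lemma spanning_subspace_of_small_Inter:
  assumes F: "\<And>V. V \<in> F \<Longrightarrow> subspace V" "\<And>V. V \<in> F \<Longrightarrow> dim V \<le> k" "F \<noteq> {}"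
    and m: "1 \<le> m" "\<And>V W. V \<in> F \<Longrightarrow> W \<in> F \<Longrightarrow> m \<le> dim (V \<inter> W)" "dim (\<Inter>F) < m"
  obtains Y where "subspace Y" "dim Y \<le> k\<^sup>2" "\<And>V. V \<in> F \<Longrightarrow> m + 1 \<le> dim (V \<inter> Y)"
proof -
  obtain A where A: "A \<in> F" using F(3) by blast
  obtain G where G: "finite G" "A \<in> G" "G \<subseteq> F" "card G \<le> Suc k"
    "dim (\<Inter>G) < m \<or> dim (\<Inter>G) + k \<le> dim A"
    using small_subfamily_small_Inter[OF F(1) A m(3), of k] by blast
  \<comment> \<open>The second alternative forces dimension 0, because
    \<open>dim A \<le> k\<close>.\<close>
  have dimG: "dim (\<Inter>G) < m" using G(5) F(2)[OF A] m(1) by linarith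
  let ?Y = "span (A \<union> \<Union>(G - {A}))"
  have "dim ?Y \<le> dim A + card (G - {A}) * (k - 1)"
  proof (intro dim_span_Union_le)
    fix B assume "B \<in> G - {A}"
    then have B: "B \<in> F" using G(3) by blast
    show "subspace B" "dim B \<le> k" using F B by auto
    show "1 \<le> dim (B \<inter> A)" using m(1) m(2)[OF B A] by simp
  qed (use G A F in auto)
  also have "\<dots> \<le> k + k * (k - 1)"
    using F(2)[OF A] G by (intro add_mono mult_right_mono) auto
  also have "\<dots> = k\<^sup>2"
    by (cases k) (auto simp: power2_eq_square)
  finally have dimY: "dim ?Y \<le> k\<^sup>2" .
  have sub: "B \<subseteq> ?Y" if "B \<in> G" for B
    using that span_superset[of "A \<union> \<Union>(G - {A})"] by blast
  have "m + 1 \<le> dim (V \<inter> ?Y)" if V: "V \<in> F" for V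
  proof (rule ccontr)
    assume "\<not> m + 1 \<le> dim (V \<inter> ?Y)"
    then have le: "dim (V \<inter> ?Y) \<le> m" by simp
    \<comment> \<open>\<open>V\<close> would meet every \<open>B \<in> G\<close> in the same \<open>m\<close>-dimensional space, which then lies in \<open>\<Inter>G\<close>.\<close>
    have "V \<inter> ?Y \<subseteq> B" if "B \<in> G" for B
    proof -
      have "V \<inter> B = V \<inter> ?Y"
      proof (intro subspace_dim_equal subspace_inter)
        show "dim (V \<inter> ?Y) \<le> dim (V \<inter> B)"
          using m(2)[of V B] V that G(3) le by fastforce
      qed (use sub[OF that] V that G(3) F(1) in auto)
      then show ?thesis by blast
    qed
    then have "dim (V \<inter> ?Y) \<le> dim (\<Inter>G)" by (intro dim_subset) blast
    moreover have "m \<le> dim (V \<inter> ?Y)"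
      using m(2)[OF V A] dim_subset[of "V \<inter> A" "V \<inter> ?Y"] sub[OF G(2)] by (meson Int_mono order_refl order_trans)
    ultimately show False using dimG by simp
  qed
  with dimY that[of ?Y] show ?thesis by simp
qed

end

section \<open>The bound, by cases on the dimension of the common intersection\<close>

theorem theorem1p15:
  fixes scale :: "'f::{field,finite} \<Rightarrow> 'v::ab_group_add \<Rightarrow> 'v"
    and Basis :: "'v set"
    and \<V> :: "'v set set"
    and L :: "nat set"
    and l :: "nat \<Rightarrow> nat"
    and s q n k :: nat
  assumes "s \<ge> 1"
    and "0 < l 1"
    and "strict_mono_on {1..s} l"
    and "L = l ` {1..s}"
    and "CARD('f) = q"
    and "finite_dimensional_vector_space scale Basis"
    and "vector_space.dim scale (UNIV :: 'v set) = n"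
    and "\<And>V. V \<in> \<V> \<Longrightarrow> module.subspace scale V"
    and "\<And>V W. V \<in> \<V> \<Longrightarrow> W \<in> \<V> \<Longrightarrow> V \<noteq> W \<Longrightarrow> vector_space.dim scale (V \<inter> W) \<in> L"
    and "k = Max (vector_space.dim scale ` \<V>)"
    and "real n \<ge> max (log (real q) ((real q ^ s - 1) * gauss_binomial q (k\<^sup>2) (l 1 + 1) + 1) + real (l 1))
                       (2 * real s + 1)"
  shows "real (card \<V>) < gauss_binomial q n s"
proof -
  interpret finite_field_vector_space scale Basis
    using assms(6) by (rule finite_field_vector_space.intro)
  define m where "m = l 1"
  have q2: "q \<ge> 2" using card_field_ge_2 assms(5) by simp
  have m: "1 \<le> m" using assms(2) by (simp add: m_def)
  have n: "2 * s + 1 \<le> n" using assms(11) by linarith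
  obtain S where s: "s = Suc S" using assms(1) by (cases s) auto
  obtain N where N: "n = Suc (Suc N)" using n s by (cases n; cases "n - 1") auto
  have "inj_on l {1..s}" using assms(3) by (rule strict_mono_on_imp_inj_on)
  then have cardL: "card L = s" by (simp add: assms(4) card_image)
  have finL: "finite L" by (simp add: assms(4))
  have minL: "m \<in> L" "\<And>x. x \<in> L \<Longrightarrow> m \<le> x"
    using assms(1) strict_mono_onD[OF assms(3), of 1] by (force simp: assms(4) m_def le_less)+
  have finV: "finite \<V>"
    by (rule finite_subset[of _ UNIV]) (auto simp: Finite_Set.finite_set)
  \<comment> \<open>This settles families with at most one member, on which the intersection
    condition says nothing.\<close>
  have gpos: "gauss_binomial q n s > 1"
  proof -
    have "1 = gauss_binomial q (Suc N) 0" by simp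
    also have "\<dots> \<le> (\<Sum>i\<le>Suc S. gauss_binomial q (Suc N) i)"
      by (intro member_le_sum gauss_binomial_nonneg q2) auto
    also have "\<dots> < gauss_binomial q n s"
      using n unfolding N s by (intro sum_gauss_binomial_less q2) auto
    finally show ?thesis .
  qed
  show ?thesis
  proof (cases "card \<V> \<le> 1")
    case True
    then show ?thesis using gpos by linarith
  next
    case False
    have ge: "m \<le> dim (V \<inter> W)" if VW: "V \<in> \<V>" "W \<in> \<V>" for V W
    proof (cases "V = W")
      case True
      \<comment> \<open>The dimension of a single member is bounded below through its intersection
        with a second one.\<close>
      have "\<V> \<noteq> {V}" using False by auto
      then obtain W' where W': "W' \<in> \<V>" "V \<noteq> W'" using VW by blast
      have "m \<le> dim (V \<inter> W')" using assms(9)[OF VW(1) W'] minL by blast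
      also have "\<dots> \<le> dim (V \<inter> W)" using True by (intro dim_subset) auto
      finally show ?thesis .
    qed (use assms(9) VW minL in blast)
    show ?thesis
    proof (cases "dim (\<Inter>\<V>) < m")
      case False
      then have "\<not> \<Inter>\<V> \<subseteq> {0}" using m dim_eq_0[of "\<Inter>\<V>"] by linarith
      then obtain x where x: "x \<in> \<Inter>\<V>" "x \<noteq> 0" by blast
      \<comment> \<open>Dividing out the line through \<open>x\<close> lowers the ambient dimension
        to \<open>n - 1\<close>, and \<open>2 * s \<le> n - 1\<close> then puts the sum strictly
        below the coefficient for \<open>n\<close> and \<open>s\<close>.\<close>
      have "real (card \<V>) \<le> (\<Sum>i\<le>card L. gauss_binomial CARD('f) (dim UNIV - dim (span {x})) i)"
      proof (rule card_intersecting_family_le)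
        fix V assume V: "V \<in> \<V>"
        show "span {x} \<subseteq> V" using V x assms(8) by (intro span_minimal) auto
      qed (use assms(8,9) finL in auto)
      also have "\<dots> = (\<Sum>i\<le>Suc S. gauss_binomial q (Suc N) i)"
        using x assms(5,7) N s cardL by simp
      also have "\<dots> < gauss_binomial q (Suc (Suc N)) (Suc S)"
        using n N s by (intro sum_gauss_binomial_less q2) auto
      finally show ?thesis by (simp add: N s)
    next
      case True
      have dimk: "dim V \<le> k" if "V \<in> \<V>" for V
        using that finV assms(10) by simp
      have "\<V> \<noteq> {}" using False by auto
      from spanning_subspace_of_small_Inter[OF assms(8) dimk this m ge True]
      obtain Y where Y: "subspace Y" "dim Y \<le> k\<^sup>2" "\<And>V. V \<in> \<V> \<Longrightarrow> m + 1 \<le> dim (V \<inter> Y)"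
        by blast
      let ?\<T> = "subspaces_of_dim Y (m + 1)"
      let ?B = "\<Sum>i\<le>S. gauss_binomial q (n - (m + 1)) i"
      \<comment> \<open>Distinct members containing a common \<open>T\<close> meet in dimension at
        least \<open>m + 1\<close>, so the value \<open>m\<close> drops out.\<close>
      have cardK: "card (L - {m}) = S"
        using minL(1) finL cardL s by simp
      have bound: "real (card {V \<in> \<V>. T \<subseteq> V}) \<le> ?B" if T: "T \<in> ?\<T>" for T
      proof -
        have "real (card {V \<in> \<V>. T \<subseteq> V}) \<le> (\<Sum>i\<le>card (L - {m}). gauss_binomial CARD('f) (dim UNIV - dim T) i)"
        proof (rule card_intersecting_family_le)
          fix V W assume VW: "V \<in> {V \<in> \<V>. T \<subseteq> V}" "W \<in> {V \<in> \<V>. T \<subseteq> V}" "V \<noteq> W"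
          then have "m + 1 \<le> dim (V \<inter> W)"
            using T dim_subset[of T "V \<inter> W"] by (auto simp: subspaces_of_dim_def)
          with VW assms(9) show "dim (V \<inter> W) \<in> L - {m}" by auto
        qed (use T assms(8) finL in \<open>auto simp: subspaces_of_dim_def\<close>)
        also have "\<dots> = ?B"
          using T assms(5,7) unfolding cardK by (simp add: subspaces_of_dim_def)
        finally show ?thesis .
      qed
      have "\<V> \<subseteq> (\<Union>T\<in>?\<T>. {V \<in> \<V>. T \<subseteq> V})"
      proof
        fix V assume V: "V \<in> \<V>"
        obtain T where T: "subspace T" "T \<subseteq> span (V \<inter> Y)" "dim T = m + 1"
          using choose_subspace_of_subspace[OF Y(3)[OF V]] by blast
        have "span (V \<inter> Y) = V \<inter> Y"
          using Y(1) assms(8)[OF V] by (simp add: subspace_inter)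
        with T V show "V \<in> (\<Union>T\<in>?\<T>. {V \<in> \<V>. T \<subseteq> V})"
          by (auto simp: subspaces_of_dim_def)
      qed
      then have "card \<V> \<le> card (\<Union>T\<in>?\<T>. {V \<in> \<V>. T \<subseteq> V})"
        using finV by (intro card_mono) auto
      also have "\<dots> \<le> (\<Sum>T\<in>?\<T>. card {V \<in> \<V>. T \<subseteq> V})"
        by (intro card_UN_le) simp
      finally have "real (card \<V>) \<le> (\<Sum>T\<in>?\<T>. real (card {V \<in> \<V>. T \<subseteq> V}))"
        by (simp flip: of_nat_sum)
      also have "\<dots> \<le> real (card ?\<T>) * ?B"
        using sum_bounded_above[of ?\<T>, OF bound] by simp
      also have "real (card ?\<T>) = gauss_binomial q (dim Y) (m + 1)"
        using card_subspaces_of_dim[OF Y(1)] assms(5) by simp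
      also have "gauss_binomial q (dim Y) (m + 1) * ?B \<le> gauss_binomial q (k\<^sup>2) (m + 1) * gauss_binomial q (Suc N) S"
      proof (intro mult_mono)
        show "gauss_binomial q (dim Y) (m + 1) \<le> gauss_binomial q (k\<^sup>2) (m + 1)"
          by (intro gauss_binomial_mono q2 Y)
        \<comment> \<open>Here \<open>N = n - 2\<close>, and \<open>m \<ge> 1\<close> gives
          \<open>n - (m + 1) \<le> N\<close>. One dimension is left over to absorb the sum into a
          single coefficient.\<close>
        have "?B \<le> (\<Sum>i\<le>S. gauss_binomial q N i)"
          using m N by (intro sum_mono gauss_binomial_mono q2) auto
        also have "\<dots> \<le> gauss_binomial q (Suc N) S"
        proof (cases S)
          case (Suc S')
          then have "2 * Suc S' \<le> N" using n N s by simp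
          from sum_gauss_binomial_less[OF q2 this] show ?thesis by (simp add: Suc)
        qed simp
        finally show "?B \<le> gauss_binomial q (Suc N) S" .
      qed (auto intro!: gauss_binomial_nonneg q2 sum_nonneg)
      finally have card_le: "real (card \<V>) \<le> gauss_binomial q (k\<^sup>2) (m + 1) * gauss_binomial q (Suc N) S" .
      let ?g = "gauss_binomial q (k\<^sup>2) (m + 1)"
      have qs: "real q ^ s > 1" using q2 s by (intro one_less_power) auto
      \<comment> \<open>The coefficient for \<open>n\<close> and \<open>s\<close> is
        \<open>(q ^ n - 1) / (q ^ s - 1)\<close> times the one for \<open>n - 1\<close> and
        \<open>s - 1\<close>, so \<open>?g\<close> only has to stay below this quotient. The
        logarithmic hypothesis gives the exponent \<open>n - l 1\<close>, which is at most
        \<open>n - 1\<close>.\<close>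
      have "(real q ^ s - 1) * ?g + 1 \<le> real q ^ (n - 1)"
      proof -
        have pos: "(real q ^ s - 1) * ?g + 1 > 0"
          using qs gauss_binomial_nonneg[OF q2, of "k\<^sup>2" "m + 1"] by (intro add_nonneg_pos mult_nonneg_nonneg) auto
        have "log (real q) ((real q ^ s - 1) * ?g + 1) \<le> real (n - 1)"
          using assms(11) m n by (simp add: m_def of_nat_diff)
        then have "(real q ^ s - 1) * ?g + 1 \<le> real q powr real (n - 1)"
          using q2 pos by (subst (asm) log_le_iff) auto
        then show ?thesis using q2 by (simp add: powr_realpow)
      qed
      also have "\<dots> < real q ^ n"
        using q2 n by (intro power_strict_increasing) auto
      finally have "?g < (real q ^ n - 1) / (real q ^ s - 1)"
        using qs by (simp add: field_simps)
      then have "?g * gauss_binomial q (Suc N) S < (real q ^ n - 1) / (real q ^ s - 1) * gauss_binomial q (Suc N) S"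
        using n N s by (intro mult_strict_right_mono gauss_binomial_pos q2) auto
      also have "\<dots> = gauss_binomial q n s"
        by (simp add: N s gauss_binomial_Suc_Suc)
      finally show ?thesis using card_le by simp
    qed
  qed
qed

end
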